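(* Let $H(t,y,z)$ be, for each integer $t$, a smooth real-valued function of $(y,z)\in\mathbb{R}^d\times\mathbb{R}^d$, and consider the discrete Hamiltonian system $$\Delta y(t)=H_z(t,y(t+1),z(t)),\qquad \Delta z(t)=-H_y(t,y(t+1),z(t)).$$ Put $S_2^{(t+1,t)}(y(t+1),z(t))=z(t)\,y(t+1)-H(t,y(t+1),z(t))$. Then the system is equivalent to $$y(t)=\frac{\partial S_2^{(t+1,t)}}{\partial z}(y(t+1),z(t)),\qquad z(t+1)=\frac{\partial S_2^{(t+1,t)}}{\partial y}(y(t+1),z(t)).$$ Moreover, in a neighbourhood of any point $(y(t+1),z(t))$ at which $$\det\left(\frac{\partial^2S_2^{(t+1,t)}}{\partial y\,\partial z}(y(t+1),z(t))\right)\neq0,$$ the discrete Hamiltonian system defines a (local) symplectomorphism $(y(t),z(t))\mapsto(y(t+1),z(t+1))$.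
   Context: Here $y(t),z(t)\in\mathbb{R}^d$, $\Delta y(t)=y(t+1)-y(t)$, $\Delta z(t)=z(t+1)-z(t)$; $H_y$ and $H_z$ are the partial gradients of $H$ with respect to $y$ and $z$; $z\,y=\sum_{i=1}^dz_iy_i$; and $\partial S_2/\partial y$, $\partial S_2/\partial z$ are the partial gradients with respect to the arguments $y(t+1)$ and $z(t)$ respectively. Symplectomorphism is with respect to the standard symplectic form $\sum_{i=1}^ddy_i\wedge dz_i$ on $\mathbb{R}^d\times\mathbb{R}^d$. *)

theory Defs
  imports "HOL-Analysis.Analysis"
begin

text \<open>
  \<open>Ck_on k S f\<close> is meant for open \<open>S\<close>, where it depends only on \<open>f\<close> restricted to \<open>S\<close>.
  It says that all iterated directional derivatives up to order \<open>k\<close> exist and are continuous;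
  on a finite-dimensional domain this is the usual class of \<open>k\<close> times continuously
  differentiable functions.
\<close>

primrec Ck_on :: "nat \<Rightarrow> 'a::euclidean_space set \<Rightarrow> ('a \<Rightarrow> 'b::euclidean_space) \<Rightarrow> bool" where
  "Ck_on 0 S f \<longleftrightarrow> continuous_on S f"
| "Ck_on (Suc k) S f \<longleftrightarrow>
     (\<forall>x\<in>S. f differentiable (at x)) \<and>
     (\<forall>v. Ck_on k S (\<lambda>x. frechet_derivative f (at x) v))"

definition smooth_on :: "'a::euclidean_space set \<Rightarrow> ('a \<Rightarrow> 'b::euclidean_space) \<Rightarrow> bool" where
  "smooth_on S f \<longleftrightarrow> (\<forall>k. Ck_on k S f)"

definition gradient :: "('a::euclidean_space \<Rightarrow> real) \<Rightarrow> 'a \<Rightarrow> 'a" where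
  "gradient f x = (THE D. GDERIV f x :> D)"

definition grad_y :: "(real^'n \<Rightarrow> real^'n \<Rightarrow> real) \<Rightarrow> real^'n \<Rightarrow> real^'n \<Rightarrow> real^'n" where
  "grad_y F y z = gradient (\<lambda>u. F u z) y"

definition grad_z :: "(real^'n \<Rightarrow> real^'n \<Rightarrow> real) \<Rightarrow> real^'n \<Rightarrow> real^'n \<Rightarrow> real^'n" where
  "grad_z F y z = gradient (\<lambda>u. F y u) z"

text \<open>The entry in row \<open>i\<close> and column \<open>j\<close> is the partial derivative
  with respect to \<open>y\<^sub>i\<close> of the partial derivative of \<open>F\<close> with respect to \<open>z\<^sub>j\<close>.\<close>

definition mixed_hessian ::
  "(real^'n \<Rightarrow> real^'n \<Rightarrow> real) \<Rightarrow> real^'n \<Rightarrow> real^'n \<Rightarrow> real^'n^'n" where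
  "mixed_hessian F y z =
     (\<chi> i j. frechet_derivative (\<lambda>u. grad_z F u z $ j) (at y) (axis i 1))"

definition fwd_diff :: "(int \<Rightarrow> 'a::ab_group_add) \<Rightarrow> int \<Rightarrow> 'a" (\<open>\<Delta>\<close>) where
  "\<Delta> x t = x (t + 1) - x t"

definition discrete_hamiltonian_at ::
  "(int \<Rightarrow> real^'n \<Rightarrow> real^'n \<Rightarrow> real) \<Rightarrow> (int \<Rightarrow> real^'n) \<Rightarrow> (int \<Rightarrow> real^'n) \<Rightarrow> int \<Rightarrow> bool" where
  "discrete_hamiltonian_at H y z t \<longleftrightarrow>
     \<Delta> y t = grad_z (H t) (y (t + 1)) (z t) \<and>
     \<Delta> z t = - grad_y (H t) (y (t + 1)) (z t)"

text \<open>The generating function of the step from \<open>t\<close> to \<open>t + 1\<close>;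
  its arguments stand for \<open>y (t + 1)\<close> and \<open>z t\<close>.\<close>

definition S\<^sub>2 ::
  "(int \<Rightarrow> real^'n \<Rightarrow> real^'n \<Rightarrow> real) \<Rightarrow> int \<Rightarrow> real^'n \<Rightarrow> real^'n \<Rightarrow> real" where
  "S\<^sub>2 H t y' z = z \<bullet> y' - H t y' z"

text \<open>The standard symplectic form, the sum of the \<open>dy\<^sub>i \<and> dz\<^sub>i\<close>, on pairs \<open>(y, z)\<close>.\<close>

definition symplectic_form :: "(real^'n) \<times> (real^'n) \<Rightarrow> (real^'n) \<times> (real^'n) \<Rightarrow> real" where
  "symplectic_form u v = (\<Sum>i\<in>UNIV. fst u $ i * snd v $ i - fst v $ i * snd u $ i)"

definition symplectomorphism ::
  "((real^'n) \<times> (real^'n)) set \<Rightarrow> ((real^'n) \<times> (real^'n)) set \<Rightarrow>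
   ((real^'n) \<times> (real^'n) \<Rightarrow> (real^'n) \<times> (real^'n)) \<Rightarrow> bool" where
  "symplectomorphism U V \<Phi> \<longleftrightarrow>
     open U \<and> open V \<and> bij_betw \<Phi> U V \<and>
     smooth_on U \<Phi> \<and> smooth_on V (inv_into U \<Phi>) \<and>
     (\<forall>p\<in>U. \<forall>u v. symplectic_form (frechet_derivative \<Phi> (at p) u) (frechet_derivative \<Phi> (at p) v)
                   = symplectic_form u v)"

text \<open>
  The discrete Hamiltonian system at time \<open>t\<close>, restricted to \<open>(y (t + 1), z t) \<in> W\<close>, is the
  graph of the symplectomorphism \<open>\<Phi>\<close> from \<open>U\<close> onto \<open>V\<close>. Only the values at \<open>t\<close> and \<open>t + 1\<close>
  of the sequences matter, so the quantifier over sequences amounts to one over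
  \<open>(y t, z t)\<close> and \<open>(y (t + 1), z (t + 1))\<close>.
\<close>

definition defines_symplectomorphism_on ::
  "(int \<Rightarrow> real^'n \<Rightarrow> real^'n \<Rightarrow> real) \<Rightarrow> int \<Rightarrow> ((real^'n) \<times> (real^'n)) set \<Rightarrow> bool" where
  "defines_symplectomorphism_on H t W \<longleftrightarrow>
     (\<exists>U V \<Phi>. symplectomorphism U V \<Phi> \<and>
        (\<forall>y z. (y (t + 1), z t) \<in> W \<and> discrete_hamiltonian_at H y z t \<longleftrightarrow>
               (y t, z t) \<in> U \<and> (y (t + 1), z (t + 1)) = \<Phi> (y t, z t)))"

end

theory Submission
  imports Defs
begin

text \<open>
  Both assertions are about the generating function \<open>F = S\<^sub>2 H t\<close>. Its partial gradients are
  \<open>z - H\<^sub>y\<close> and \<open>y' - H\<^sub>z\<close>, so the two forms of the system differ by a rearrangement of terms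
  (\<open>grad_S\<^sub>2\<close>).

  For the second assertion, the solutions of one step form a graph over the mixed variables
  \<open>w = (y', z)\<close>, namely the pairs \<open>(A w, B w)\<close> with \<open>A w = (F\<^sub>z w, z)\<close> and
  \<open>B w = (y', F\<^sub>y w)\<close>. The derivative of \<open>A\<close> is
  invertible exactly if the mixed Hessian is, and the same holds for \<open>B\<close>. Near a point where the
  determinant does not vanish, both are therefore diffeomorphisms onto open sets
  (\<open>smooth_inverse_function\<close>), and the step is the map \<open>\<Phi> = B \<circ> A\<inverse>\<close>. Let \<open>G = (F\<^sub>y, F\<^sub>z)\<close> be the full
  gradient. For tangent vectors \<open>m, n\<close> at \<open>w\<close>, the equation \<open>\<omega>(DB m, DB n) = \<omega>(DA m, DA n)\<close> says
  precisely \<open>m \<bullet> DG n = n \<bullet> DG m\<close>, which is the symmetry of second derivatives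
  (\<open>gradient_derivative_symmetric\<close>). Since \<open>DA\<close> is onto, \<open>\<Phi>\<close> is symplectic
  (\<open>generating_function_symplectomorphism\<close>).

  The supporting analysis is the calculus of \<open>C\<^sup>k\<close> maps on open sets, the smoothness of local inverses
  (which rests on that of \<open>x \<mapsto> inv (L x) v\<close> for a smooth family \<open>L\<close> of invertible operators), and the
  symmetry of second derivatives.
\<close>

section \<open>Calculus of continuously differentiable maps\<close>

text \<open>
  \<open>Ck_on\<close> evaluates derivatives at points of \<open>S\<close> without restricting to \<open>S\<close>; openness makes them
  depend on the values on \<open>S\<close> alone. This is what allows derivatives to be replaced by explicit
  formulas that are valid on \<open>S\<close> only, as in the introduction rule below.
\<close>

lemma Ck_on_cong:
  assumes "open S" "\<And>x. x \<in> S \<Longrightarrow> f x = g x" "Ck_on k S f"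
  shows "Ck_on k S g"
  using assms(2,3)
proof (induction k arbitrary: f g)
  case 0
  then show ?case by (simp add: continuous_on_cong[of S S f g])
next
  case (Suc k)
  have D: "(g has_derivative frechet_derivative f (at x)) (at x)" if "x \<in> S" for x
  proof (rule has_derivative_transform_within_open)
    show "(f has_derivative frechet_derivative f (at x)) (at x)"
      using Suc.prems(2) that by (simp add: frechet_derivative_works[symmetric])
  qed (use assms(1) that Suc.prems(1) in auto)
  have eq: "frechet_derivative f (at x) = frechet_derivative g (at x)" if "x \<in> S" for x
    using frechet_derivative_at[OF D[OF that]] .
  have "Ck_on k S (\<lambda>x. frechet_derivative g (at x) v)" for v
  proof (rule Suc.IH)
    show "Ck_on k S (\<lambda>x. frechet_derivative f (at x) v)"
      using Suc.prems(2) by simp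
  qed (simp add: eq)
  moreover have "g differentiable (at x)" if "x \<in> S" for x
    using D[OF that] by (auto simp: differentiable_def)
  ultimately show ?case by simp
qed

lemma Ck_on_SucI:
  assumes "open S"
    and D: "\<And>x. x \<in> S \<Longrightarrow> (f has_derivative f' x) (at x)"
    and C: "\<And>v. Ck_on k S (\<lambda>x. f' x v)"
  shows "Ck_on (Suc k) S f"
proof -
  have "Ck_on k S (\<lambda>x. frechet_derivative f (at x) v)" for v
    by (rule Ck_on_cong[OF \<open>open S\<close> _ C[of v]]) (metis D frechet_derivative_at)
  then show ?thesis
    using D by (auto simp: differentiable_def)
qed

lemma Ck_on_SucD:
  assumes "Ck_on (Suc k) S f"
  shows "Ck_on k S f"
  using assms
proof (induction k arbitrary: f)
  case 0
  then show ?case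
    by (auto intro!: continuous_at_imp_continuous_on differentiable_imp_continuous_within)
qed auto

lemma Ck_on_has_derivative:
  assumes "Ck_on (Suc k) S f" "x \<in> S"
  shows "(f has_derivative frechet_derivative f (at x)) (at x)"
  using assms by (simp add: frechet_derivative_works[symmetric])

lemma Ck_on_subset: "Ck_on k S f \<Longrightarrow> T \<subseteq> S \<Longrightarrow> Ck_on k T f"
  by (induction k arbitrary: f) (auto intro: continuous_on_subset)

lemma Ck_on_linear:
  assumes "open S" "bounded_linear l" "Ck_on k S f"
  shows "Ck_on k S (\<lambda>x. l (f x))"
  using assms(3)
proof (induction k arbitrary: f)
  case 0
  then show ?case by (simp add: bounded_linear.continuous_on[OF assms(2)])
next
  case (Suc k)
  show ?case
  proof (rule Ck_on_SucI[OF \<open>open S\<close>])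
    show "((\<lambda>x. l (f x)) has_derivative (\<lambda>v. l (frechet_derivative f (at x) v))) (at x)"
      if "x \<in> S" for x
      by (rule bounded_linear.has_derivative[OF assms(2) Ck_on_has_derivative[OF Suc.prems that]])
  qed (use Suc in simp)
qed

lemma Ck_on_const [simp]:
  assumes "open S" shows "Ck_on k S (\<lambda>x. c)"
proof (induction k arbitrary: c)
  case (Suc k)
  show ?case
    by (rule Ck_on_SucI[OF assms, of _ "\<lambda>x v. 0"]) (use Suc in auto)
qed simp

lemma Ck_on_ident:
  assumes "open S" shows "Ck_on k S (\<lambda>x. x)"
proof (cases k)
  case (Suc m)
  show ?thesis unfolding Suc
    by (rule Ck_on_SucI[OF assms, of _ "\<lambda>x v. v"]) (use assms in auto)
qed simp

lemma Ck_on_add: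
  assumes "open S" "Ck_on k S f" "Ck_on k S g"
  shows "Ck_on k S (\<lambda>x. f x + g x)"
  using assms(2,3)
proof (induction k arbitrary: f g)
  case 0
  then show ?case by (simp add: continuous_on_add)
next
  case (Suc k)
  show ?case
    by (rule Ck_on_SucI[OF \<open>open S\<close>],
        rule has_derivative_add[OF Ck_on_has_derivative[OF Suc.prems(1)]
          Ck_on_has_derivative[OF Suc.prems(2)]])
      (use Suc in auto)
qed

lemma Ck_on_sum:
  assumes "open S" "\<And>i. i \<in> I \<Longrightarrow> Ck_on k S (f i)"
  shows "Ck_on k S (\<lambda>x. \<Sum>i\<in>I. f i x)"
  using assms(2)
  by (induction I rule: infinite_finite_induct) (auto intro!: Ck_on_add assms(1) simp: assms(1))

lemma Ck_on_scaleR: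
  fixes f :: "'a::euclidean_space \<Rightarrow> real"
  assumes "open S" "Ck_on k S f" "Ck_on k S g"
  shows "Ck_on k S (\<lambda>x. f x *\<^sub>R g x)"
  using assms(2,3)
proof (induction k arbitrary: f g)
  case 0
  then show ?case by (simp add: continuous_on_scaleR)
next
  case (Suc k)
  show ?case
  proof (rule Ck_on_SucI[OF \<open>open S\<close>])
    show "Ck_on k S (\<lambda>x. f x *\<^sub>R frechet_derivative g (at x) v + frechet_derivative f (at x) v *\<^sub>R g x)"
      for v
      using Suc.prems Ck_on_SucD[OF Suc.prems(1)] Ck_on_SucD[OF Suc.prems(2)]
      by (intro Ck_on_add Suc.IH \<open>open S\<close>) auto
  qed (rule has_derivative_scaleR[OF Ck_on_has_derivative[OF Suc.prems(1)] Ck_on_has_derivative[OF Suc.prems(2)]])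
qed

lemma linear_euclidean_expand:
  fixes l :: "'a::euclidean_space \<Rightarrow> 'b::real_vector"
  assumes "linear l"
  shows "l v = (\<Sum>b\<in>Basis. (v \<bullet> b) *\<^sub>R l b)"
proof -
  have "l v = l (\<Sum>b\<in>Basis. (v \<bullet> b) *\<^sub>R b)"
    by (simp add: euclidean_representation)
  also have "\<dots> = (\<Sum>b\<in>Basis. (v \<bullet> b) *\<^sub>R l b)"
    using assms by (simp add: linear_sum linear_scale)
  finally show ?thesis .
qed

text \<open>
  Regularity of an operator family is only known pointwise, vector by vector. Expanding the
  argument in the standard basis reduces a varying argument to finitely many products, which
  gives the chain rule and, later, the regularity of inverse operators without operator norms.
\<close>

lemma Ck_on_family_apply:
  assumes "open S" "\<And>x. x \<in> S \<Longrightarrow> linear (L x)"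
    and "\<And>v. Ck_on k S (\<lambda>x. L x v)" "Ck_on k S w"
  shows "Ck_on k S (\<lambda>x. L x (w x))"
proof (rule Ck_on_cong[OF \<open>open S\<close>])
  show "Ck_on k S (\<lambda>x. \<Sum>b\<in>Basis. (w x \<bullet> b) *\<^sub>R L x b)"
    by (intro Ck_on_sum Ck_on_scaleR \<open>open S\<close> assms(3)
        Ck_on_linear[OF \<open>open S\<close> bounded_linear_inner_left] assms(4))
qed (simp add: linear_euclidean_expand[OF assms(2), symmetric])

lemma Ck_on_compose:
  assumes "open S" "open T" "f ` S \<subseteq> T" "Ck_on k S f" "Ck_on k T g"
  shows "Ck_on k S (\<lambda>x. g (f x))"
  using assms(4,5)
proof (induction k arbitrary: g)
  case 0
  then show ?case using assms(3) by (auto intro: continuous_on_compose2)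
next
  case (Suc k)
  show ?case
  proof (rule Ck_on_SucI[OF \<open>open S\<close>])
    fix x assume "x \<in> S"
    then have "f x \<in> T" using assms(3) by auto
    show "((\<lambda>x. g (f x)) has_derivative
        (\<lambda>v. frechet_derivative g (at (f x)) (frechet_derivative f (at x) v))) (at x)"
      by (rule has_derivative_compose[OF Ck_on_has_derivative[OF Suc.prems(1) \<open>x \<in> S\<close>]
            Ck_on_has_derivative[OF Suc.prems(2) \<open>f x \<in> T\<close>]])
  next
    fix v
    show "Ck_on k S (\<lambda>x. frechet_derivative g (at (f x)) (frechet_derivative f (at x) v))"
    proof (rule Ck_on_family_apply[OF \<open>open S\<close>, of "\<lambda>x. frechet_derivative g (at (f x))"])
      show "linear (frechet_derivative g (at (f x)))" if "x \<in> S" for x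
        using Ck_on_has_derivative[OF Suc.prems(2), of "f x"] assms(3) that
        by (auto intro: has_derivative_linear)
      show "Ck_on k S (\<lambda>x. frechet_derivative g (at (f x)) b)" for b
        using Suc.prems(2) Ck_on_SucD[OF Suc.prems(1)] by (intro Suc.IH) auto
      show "Ck_on k S (\<lambda>x. frechet_derivative f (at x) v)"
        using Suc.prems(1) by simp
    qed
  qed
qed

lemma smooth_on_has_derivative:
  assumes "smooth_on S f" "x \<in> S"
  shows "(f has_derivative frechet_derivative f (at x)) (at x)"
  using Ck_on_has_derivative assms unfolding smooth_on_def by blast

lemma smooth_on_differentiable:
  "smooth_on S f \<Longrightarrow> x \<in> S \<Longrightarrow> f differentiable (at x)"
  using smooth_on_has_derivative by (auto simp: differentiable_def)

lemma smooth_on_linear: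
  "open S \<Longrightarrow> bounded_linear l \<Longrightarrow> smooth_on S f \<Longrightarrow> smooth_on S (\<lambda>x. l (f x))"
  by (simp add: smooth_on_def Ck_on_linear)

lemma smooth_on_bounded_linear: "open S \<Longrightarrow> bounded_linear l \<Longrightarrow> smooth_on S l"
  by (simp add: smooth_on_def Ck_on_linear[OF _ _ Ck_on_ident])

lemma smooth_on_compose:
  "open S \<Longrightarrow> open T \<Longrightarrow> f ` S \<subseteq> T \<Longrightarrow> smooth_on S f \<Longrightarrow> smooth_on T g \<Longrightarrow> smooth_on S (\<lambda>x. g (f x))"
  by (simp add: smooth_on_def Ck_on_compose)

lemma smooth_on_subset: "smooth_on S f \<Longrightarrow> T \<subseteq> S \<Longrightarrow> smooth_on T f"
  by (auto simp: smooth_on_def intro: Ck_on_subset)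

lemma smooth_on_cong:
  "open S \<Longrightarrow> (\<And>x. x \<in> S \<Longrightarrow> f x = g x) \<Longrightarrow> smooth_on S f \<Longrightarrow> smooth_on S g"
  by (auto simp: smooth_on_def intro: Ck_on_cong)

lemma smooth_on_Pair:
  assumes "open S" "smooth_on S f" "smooth_on S g"
  shows "smooth_on S (\<lambda>x. (f x, g x))"
proof -
  have "bounded_linear (\<lambda>a. (a, 0))" "bounded_linear (\<lambda>b. (0, b))"
    by (auto intro: bounded_linear_Pair bounded_linear_ident bounded_linear_zero)
  then have "Ck_on k S (\<lambda>x. (f x, 0) + (0, g x))" for k
    using assms unfolding smooth_on_def
    by (intro Ck_on_add Ck_on_linear[of S "\<lambda>a. (a, 0)"] Ck_on_linear[of S "\<lambda>a. (0, a)"]) auto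
  then show ?thesis by (simp add: smooth_on_def)
qed

section \<open>The inverse function theorem for smooth maps\<close>

lemma linear_inv_of_bij:
  assumes "linear f" "bij f"
  shows "linear (inv f)"
proof (rule linearI)
  have s: "f (inv f x) = x" for x using assms(2) by (simp add: bij_is_surj surj_f_inv_f)
  have i: "inv f (f x) = x" for x using assms(2) by (simp add: bij_is_inj)
  show "inv f (a + b) = inv f a + inv f b" for a b
    by (metis i linear_add[OF assms(1)] s)
  show "inv f (r *\<^sub>R b) = r *\<^sub>R inv f b" for r b
    by (metis i linear_scale[OF assms(1)] s)
qed

text \<open>
  A product rule that asks for mere continuity of the second factor. It is available because the
  first factor vanishes at the point, and it breaks the circle in differentiating \<open>x \<mapsto> inv (L x) v\<close>,
  where the inverse family is known to be continuous but not yet to be differentiable.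
\<close>

lemma has_derivative_vanishing_scaleR:
  fixes \<phi> :: "'a::real_normed_vector \<Rightarrow> real"
  assumes D: "(\<phi> has_derivative \<phi>') (at p)" and z: "\<phi> p = 0" and c: "isCont c p"
  shows "((\<lambda>x. \<phi> x *\<^sub>R c x) has_derivative (\<lambda>h. \<phi>' h *\<^sub>R c p)) (at p)"
proof -
  interpret bounded_linear \<phi>' using D by (rule has_derivative_bounded_linear)
  obtain K where K: "\<And>x. norm (\<phi>' x) \<le> norm x * K" using bounded by blast
  define r where "r y = (\<phi> y - \<phi> p - \<phi>' (y - p)) /\<^sub>R norm (y - p)" for y
  have r: "(r \<longlongrightarrow> 0) (at p)"
    using D unfolding has_derivative_at_within r_def by simp
  have cc: "((\<lambda>y. c y - c p) \<longlongrightarrow> 0) (at p)"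
    using c by (simp add: isCont_def LIM_zero)
  have 1: "((\<lambda>x. \<phi> x *\<^sub>R (c x - c p)) has_derivative (\<lambda>h. 0)) (at p)"
  proof (rule has_derivativeI)
    have "((\<lambda>y. (\<phi> y *\<^sub>R (c y - c p)) /\<^sub>R norm (y - p)) \<longlongrightarrow> 0) (at p)"
    proof (rule Lim_null_comparison)
      show "((\<lambda>y. (norm (r y) + K) * norm (c y - c p)) \<longlongrightarrow> 0) (at p)"
        using tendsto_mult[OF tendsto_add[OF tendsto_norm[OF r] tendsto_const] tendsto_norm[OF cc]]
        by simp
      have "norm ((\<phi> y *\<^sub>R (c y - c p)) /\<^sub>R norm (y - p)) \<le> (norm (r y) + K) * norm (c y - c p)"
        if "y \<noteq> p" for y
      proof -
        have "\<phi> y / norm (y - p) = r y + \<phi>' (y - p) /\<^sub>R norm (y - p)"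
          using that by (simp add: r_def z field_simps)
        then have "\<bar>\<phi> y\<bar> / norm (y - p) = norm (r y + \<phi>' (y - p) /\<^sub>R norm (y - p))"
          by (metis abs_divide abs_norm_cancel real_norm_def)
        also have "\<dots> \<le> norm (r y) + norm (\<phi>' (y - p) /\<^sub>R norm (y - p))"
          by (rule norm_triangle_ineq)
        also have "norm (\<phi>' (y - p) /\<^sub>R norm (y - p)) \<le> K"
          using K[of "y - p"] that by (simp add: field_simps)
        finally have "\<bar>\<phi> y\<bar> / norm (y - p) * norm (c y - c p) \<le> (norm (r y) + K) * norm (c y - c p)"
          by (intro mult_right_mono) auto
        then show ?thesis by (simp add: divide_inverse abs_mult mult_ac)
      qed
      then show "\<forall>\<^sub>F y in at p. norm ((\<phi> y *\<^sub>R (c y - c p)) /\<^sub>R norm (y - p))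
                   \<le> (norm (r y) + K) * norm (c y - c p)"
        by (simp add: eventually_at_filter)
    qed
    then show "((\<lambda>y. (\<phi> y *\<^sub>R (c y - c p) - \<phi> p *\<^sub>R (c p - c p) - 0) /\<^sub>R norm (y - p)) \<longlongrightarrow> 0) (at p)"
      by simp
  qed simp
  have 2: "((\<lambda>x. \<phi> x *\<^sub>R c p) has_derivative (\<lambda>h. \<phi>' h *\<^sub>R c p)) (at p)"
    by (rule has_derivative_scaleR_left[OF D])
  show ?thesis
    using has_derivative_add[OF 1 2] by (simp add: algebra_simps)
qed

text \<open>
  An injective operator is bounded below by some \<open>c > 0\<close>, and nearby operators are then bounded below
  by \<open>c / 2\<close>. This turns the identity \<open>L x (inv (L x) v - inv (L p) v) = L p w - L x w\<close> with
  \<open>w = inv (L p) v\<close> into an estimate of the difference of the inverses.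
\<close>

lemma isCont_inv_family:
  fixes L :: "'a::euclidean_space \<Rightarrow> 'b::euclidean_space \<Rightarrow> 'b"
  assumes "open S" "p \<in> S"
    and lin: "\<And>x. x \<in> S \<Longrightarrow> linear (L x)" and bij: "\<And>x. x \<in> S \<Longrightarrow> bij (L x)"
    and cont: "\<And>v. isCont (\<lambda>x. L x v) p"
  shows "isCont (\<lambda>x. inv (L x) v) p"
proof -
  obtain c where "c > 0" and c: "\<And>w. c * norm w \<le> norm (L p w)"
    using linear_inj_bounded_below_pos[OF lin bij_is_inj[OF bij]] \<open>p \<in> S\<close> by blast
  define e where "e x = (\<Sum>b\<in>Basis. norm (L x b - L p b))" for x
  have S: "\<forall>\<^sub>F x in at p. x \<in> S"
    using \<open>open S\<close> \<open>p \<in> S\<close> by (auto intro: eventually_at_in_open')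
  have dist: "norm (L x w - L p w) \<le> norm w * e x" if "x \<in> S" for x w
  proof -
    have "linear (\<lambda>w. L x w - L p w)"
      using lin that \<open>p \<in> S\<close> by (intro linear_compose_sub) auto
    from linear_euclidean_expand[OF this, of w]
    have "norm (L x w - L p w) \<le> (\<Sum>b\<in>Basis. norm ((w \<bullet> b) *\<^sub>R (L x b - L p b)))"
      by (simp only: norm_sum)
    also have "\<dots> \<le> (\<Sum>b\<in>Basis. norm w * norm (L x b - L p b))"
      by (rule sum_mono) (simp add: Basis_le_norm mult_right_mono)
    finally show ?thesis by (simp add: e_def sum_distrib_left)
  qed
  have "(e \<longlongrightarrow> (\<Sum>b\<in>(Basis::'b set). norm (L p b - L p b))) (at p)"
    unfolding e_def by (intro tendsto_sum tendsto_norm tendsto_diff tendsto_const isContD cont)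
  then have "(e \<longlongrightarrow> 0) (at p)" by simp
  then have "\<forall>\<^sub>F x in at p. e x < c / 2"
    using \<open>c > 0\<close> by (intro order_tendstoD) auto
  then have bd: "\<forall>\<^sub>F x in at p. norm (inv (L x) v - inv (L p) v)
                   \<le> norm (L x (inv (L p) v) - L p (inv (L p) v)) * (2 / c)"
    using S
  proof eventually_elim
    case (elim x)
    let ?d = "inv (L x) v - inv (L p) v"
    have sx: "L x (inv (L x) v) = v" and sp: "L p (inv (L p) v) = v"
      by (simp_all add: surj_f_inv_f bij_is_surj bij elim(2) \<open>p \<in> S\<close>)
    have "c * norm ?d \<le> norm (L p ?d)" by (rule c)
    also have "L p ?d = L x ?d - (L x ?d - L p ?d)" by simp
    also have "norm \<dots> \<le> norm (L x ?d) + norm (L x ?d - L p ?d)" by (rule norm_triangle_ineq4)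
    also have "norm (L x ?d - L p ?d) \<le> norm ?d * (c / 2)"
      using dist[OF elim(2), of ?d] elim(1) by (meson less_imp_le mult_left_mono norm_ge_zero order_trans)
    also have "L x ?d = - (L x (inv (L p) v) - L p (inv (L p) v))"
      using lin[OF elim(2)] by (simp add: linear_diff sx sp)
    finally show ?case using \<open>c > 0\<close> by (simp add: field_simps norm_minus_commute)
  qed
  have "((\<lambda>x. norm (L x (inv (L p) v) - L p (inv (L p) v)) * (2 / c)) \<longlongrightarrow> 0) (at p)"
    using tendsto_mult[OF tendsto_norm[OF LIM_zero[OF isContD[OF cont[of "inv (L p) v"]]]] tendsto_const[of "2 / c"]]
    by simp
  then have "((\<lambda>x. inv (L x) v - inv (L p) v) \<longlongrightarrow> 0) (at p)"
    by (rule Lim_null_comparison[OF bd])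
  then show ?thesis by (simp add: isCont_def LIM_zero_iff)
qed

text \<open>
  The resolvent identity \<open>inv (L x) v = w + inv (L x) (L p w - L x w)\<close> with \<open>w = inv (L p) v\<close> shows
  the increment as a continuous family applied to a differentiable vector that vanishes at \<open>p\<close>.
\<close>

lemma has_derivative_inv_family:
  fixes L :: "'a::euclidean_space \<Rightarrow> 'b::euclidean_space \<Rightarrow> 'b"
  assumes "open S" "p \<in> S"
    and lin: "\<And>x. x \<in> S \<Longrightarrow> linear (L x)" and bij: "\<And>x. x \<in> S \<Longrightarrow> bij (L x)"
    and D: "\<And>v. ((\<lambda>x. L x v) has_derivative (\<lambda>h. L' h v)) (at p)"
  shows "((\<lambda>x. inv (L x) v) has_derivative (\<lambda>h. inv (L p) (- L' h (inv (L p) v)))) (at p)"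
proof -
  define w where "w = inv (L p) v"
  define e where "e x = L p w - L x w" for x
  have D_e: "((\<lambda>x. e x \<bullet> b) has_derivative (\<lambda>h. (- L' h w) \<bullet> b)) (at p)" for b
    unfolding e_def by (auto intro!: derivative_eq_intros D)
  have cont: "isCont (\<lambda>x. inv (L x) b) p" for b
    by (rule isCont_inv_family[OF assms(1-4)]) (use D has_derivative_continuous in blast)+
  have linv: "linear (inv (L x))" if "x \<in> S" for x
    using lin bij that by (intro linear_inv_of_bij)
  have "((\<lambda>x. w + (\<Sum>b\<in>Basis. (e x \<bullet> b) *\<^sub>R inv (L x) b)) has_derivative
         (\<lambda>h. 0 + (\<Sum>b\<in>Basis. ((- L' h w) \<bullet> b) *\<^sub>R inv (L p) b))) (at p)"
    by (intro has_derivative_add has_derivative_const has_derivative_sum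
        has_derivative_vanishing_scaleR D_e cont) (simp add: e_def)
  also have "(\<lambda>h. 0 + (\<Sum>b\<in>Basis. ((- L' h w) \<bullet> b) *\<^sub>R inv (L p) b)) = (\<lambda>h. inv (L p) (- L' h w))"
    by (simp only: add_0 linear_euclidean_expand[OF linv[OF \<open>p \<in> S\<close>], symmetric])
  finally show ?thesis
    unfolding w_def[symmetric]
  proof (rule has_derivative_transform_within_open)
    fix x assume "x \<in> S"
    have s: "L p w = v" "\<And>u. inv (L x) (L x u) = u"
      by (simp_all add: w_def bij_is_surj surj_f_inv_f bij_is_inj bij \<open>x \<in> S\<close> \<open>p \<in> S\<close>)
    have "(\<Sum>b\<in>Basis. (e x \<bullet> b) *\<^sub>R inv (L x) b) = inv (L x) (e x)"
      by (rule linear_euclidean_expand[OF linv[OF \<open>x \<in> S\<close>], symmetric])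
    also have "\<dots> = inv (L x) v - w"
      using linv[OF \<open>x \<in> S\<close>] by (simp add: e_def linear_diff s)
    finally show "w + (\<Sum>b\<in>Basis. (e x \<bullet> b) *\<^sub>R inv (L x) b) = inv (L x) v" by simp
  qed (use assms in auto)
qed

text \<open>
  The derivative of the inverse family is again composed of inverses and of derivatives of \<open>L\<close>, both
  of which are regular of the next lower order; hence no explicit formula for the inverse, such as
  Cramer's rule, enters.
\<close>

lemma Ck_on_inv_family:
  fixes L :: "'a::euclidean_space \<Rightarrow> 'b::euclidean_space \<Rightarrow> 'b"
  assumes "open S"
    and lin: "\<And>x. x \<in> S \<Longrightarrow> linear (L x)" and bij: "\<And>x. x \<in> S \<Longrightarrow> bij (L x)"
    and "\<And>v. Ck_on k S (\<lambda>x. L x v)"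
  shows "Ck_on k S (\<lambda>x. inv (L x) v)"
  using assms(4)
proof (induction k arbitrary: v)
  case 0
  then have "isCont (\<lambda>x. L x v) p" if "p \<in> S" for p v
    using that \<open>open S\<close> by (simp add: continuous_on_eq_continuous_at)
  then show ?case
    by (auto intro!: continuous_at_imp_continuous_on isCont_inv_family[OF \<open>open S\<close> _ lin bij])
next
  case (Suc k)
  have IH: "Ck_on k S (\<lambda>x. inv (L x) v)" for v
    using Suc.IH Ck_on_SucD[OF Suc.prems] by blast
  define L' where "L' x h w = frechet_derivative (\<lambda>y. L y w) (at x) h" for x h w
  have D: "((\<lambda>x. L x w) has_derivative (\<lambda>h. L' x h w)) (at x)" if "x \<in> S" for x w
    unfolding L'_def using Ck_on_has_derivative[OF Suc.prems that] by simp
  have "linear (L' x h)" if "x \<in> S" for x h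
  proof (rule linearI)
    fix a b :: 'b and r :: real
    have "((\<lambda>x. L x a + L x b) has_derivative (\<lambda>h. L' x h a + L' x h b)) (at x)"
      by (intro has_derivative_add D that)
    then have "((\<lambda>x. L x (a + b)) has_derivative (\<lambda>h. L' x h a + L' x h b)) (at x)"
      by (rule has_derivative_transform_within_open[OF _ \<open>open S\<close> that]) (simp add: lin linear_add)
    from has_derivative_unique[OF D[OF that] this]
    show "L' x h (a + b) = L' x h a + L' x h b" by meson
    have "((\<lambda>x. r *\<^sub>R L x b) has_derivative (\<lambda>h. r *\<^sub>R L' x h b)) (at x)"
      by (intro has_derivative_scaleR_right D that)
    then have "((\<lambda>x. L x (r *\<^sub>R b)) has_derivative (\<lambda>h. r *\<^sub>R L' x h b)) (at x)"
      by (rule has_derivative_transform_within_open[OF _ \<open>open S\<close> that]) (simp add: lin linear_scale)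
    from has_derivative_unique[OF D[OF that] this]
    show "L' x h (r *\<^sub>R b) = r *\<^sub>R L' x h b" by meson
  qed
  then have "Ck_on k S (\<lambda>x. L' x h (inv (L x) v))" for h
    by (rule Ck_on_family_apply[OF \<open>open S\<close>, of "\<lambda>x. L' x h"])
      (use Suc.prems IH in \<open>simp_all add: L'_def\<close>)
  then have C: "Ck_on k S (\<lambda>x. - L' x h (inv (L x) v))" for h
    by (rule Ck_on_linear[OF \<open>open S\<close> bounded_linear_minus[OF bounded_linear_ident]])
  have C2: "Ck_on k S (\<lambda>x. inv (L x) (- L' x h (inv (L x) v)))" for h
    by (rule Ck_on_family_apply[OF \<open>open S\<close>, of "\<lambda>x. inv (L x)"])
      (use C IH lin bij in \<open>auto intro: linear_inv_of_bij\<close>)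
  show ?case
    by (rule Ck_on_SucI[OF \<open>open S\<close> has_derivative_inv_family[OF \<open>open S\<close> _ lin bij D] C2])
qed

text \<open>
  The local inverse \<open>g\<close> satisfies \<open>Dg y = inv (Df (g y))\<close>. The right-hand side is as regular as \<open>g\<close>, so
  \<open>g\<close> gains one order of differentiability, and this repeats indefinitely.
\<close>

theorem smooth_inverse_function:
  fixes f :: "'a::euclidean_space \<Rightarrow> 'a"
  assumes "open S" and smooth: "smooth_on S f" and "p \<in> S"
    and inj: "inj (frechet_derivative f (at p))"
  obtains U V g where "open U" "U \<subseteq> S" "p \<in> U" "open V" "homeomorphism U V f g" "smooth_on V g"
    "\<And>x. x \<in> U \<Longrightarrow> bij (frechet_derivative f (at x))"
proof -
  let ?D = "\<lambda>x. frechet_derivative f (at x)"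
  have D: "(f has_derivative ?D x) (at x)" if "x \<in> S" for x
    using Ck_on_has_derivative that smooth unfolding smooth_on_def by blast
  have blf: "blinfun_apply (Blinfun (?D x)) = ?D x" if "x \<in> S" for x
    using D[OF that] by (simp add: bounded_linear_Blinfun_apply has_derivative_bounded_linear)
  have D': "(f has_derivative blinfun_apply (Blinfun (?D x))) (at x)" if "x \<in> S" for x
    unfolding blf[OF that] by (rule D[OF that])
  have "Ck_on 1 S f" using smooth by (simp add: smooth_on_def)
  then have "continuous_on S (\<lambda>x. ?D x v)" for v by simp
  then have "continuous_on S (\<lambda>x. blinfun_apply (Blinfun (?D x)) v)" for v
    by (subst continuous_on_cong[OF refl, of _ _ "\<lambda>x. ?D x v"]) (auto simp: blf)
  then have cont: "continuous_on S (\<lambda>x. Blinfun (?D x))"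
    by (intro continuous_on_blinfun_componentwise)
  obtain l where l: "linear l" "l \<circ> ?D p = id"
    using linear_injective_left_inverse[OF has_derivative_linear[OF D[OF \<open>p \<in> S\<close>]] inj] by blast
  have inv: "Blinfun l o\<^sub>L Blinfun (?D p) = id_blinfun"
    using l blf[OF \<open>p \<in> S\<close>]
    by (intro blinfun_eqI) (simp add: bounded_linear_Blinfun_apply linear_conv_bounded_linear[symmetric]
        o_def fun_eq_iff)
  obtain U V g g' where *: "open U" "U \<subseteq> S" "p \<in> U" "open V" "homeomorphism U V f g"
    "\<And>y. y \<in> V \<Longrightarrow> (g has_derivative (g' y)) (at y)"
    "\<And>y. y \<in> V \<Longrightarrow> g' y = inv (blinfun_apply (Blinfun (?D (g y))))"
    "\<And>y. y \<in> V \<Longrightarrow> bij (blinfun_apply (Blinfun (?D (g y))))"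
    by (rule inverse_function_theorem[OF \<open>open S\<close> D' cont \<open>p \<in> S\<close> inv]) (assumption | rule that)+
  have gV: "g ` V = U" and gf: "\<And>x. x \<in> U \<Longrightarrow> g (f x) = x" and fU: "f ` U = V"
    and g_cont: "continuous_on V g"
    using *(5) by (auto simp: homeomorphism_def)
  have bij: "bij (?D x)" if "x \<in> U" for x
    using *(8)[of "f x"] gf[OF that] fU that blf[of x] *(2) by auto
  have Dg: "(g has_derivative inv (?D (g y))) (at y)" if "y \<in> V" for y
    using *(6,7)[OF that] blf[of "g y"] gV that *(2) by auto
  have "Ck_on k V g" for k
  proof (induction k)
    case (Suc k)
    have "Ck_on k U (\<lambda>x. inv (?D x) v)" for v
    proof (rule Ck_on_inv_family[OF \<open>open U\<close>])
      show "linear (?D x)" if "x \<in> U" for x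
        using D *(2) that by (auto intro: has_derivative_linear)
      have "Ck_on (Suc k) S f" using smooth unfolding smooth_on_def by blast
      then show "Ck_on k U (\<lambda>x. ?D x v)" for v
        using *(2) by (auto intro: Ck_on_subset)
    qed (use bij in auto)
    then have "Ck_on k V (\<lambda>y. inv (?D (g y)) v)" for v
      by (intro Ck_on_compose[OF \<open>open V\<close> \<open>open U\<close> _ Suc]) (auto simp: gV)
    then show ?case
      by (intro Ck_on_SucI[OF \<open>open V\<close> Dg])
  qed (simp add: g_cont)
  then show thesis
    using that * bij by (simp add: smooth_on_def)
qed

section \<open>Symmetry of second derivatives\<close>

lemma has_derivative_on_line:
  fixes F :: "'a::real_normed_vector \<Rightarrow> real"
  assumes "(F has_derivative F') (at (q + s *\<^sub>R u))"
  shows "((\<lambda>s. F (q + s *\<^sub>R u)) has_real_derivative F' u) (at s)"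
proof -
  have "((\<lambda>s. q + s *\<^sub>R u) has_derivative (\<lambda>d. d *\<^sub>R u)) (at s)"
    by (auto intro!: derivative_eq_intros)
  from has_derivative_compose[OF this assms]
  have "((\<lambda>s. F (q + s *\<^sub>R u)) has_derivative (\<lambda>d. F' (d *\<^sub>R u))) (at s)" .
  moreover have "(\<lambda>d. F' (d *\<^sub>R u)) = (*) (F' u)"
    using linear_scale[OF has_derivative_linear[OF assms]] by (auto simp: fun_eq_iff)
  ultimately show ?thesis by (simp add: has_field_derivative_def)
qed

text \<open>
  The second difference is symmetric in \<open>u\<close> and \<open>v\<close>, whereas this representation, obtained from two
  applications of the mean value theorem, is not; comparing the two orders yields the symmetry of
  second derivatives.
\<close>

lemma second_difference_mean_value:
  fixes F :: "'a::euclidean_space \<Rightarrow> real"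
  assumes C: "Ck_on 2 S F" and "h > 0"
    and S: "\<And>s t. s \<in> {0..h} \<Longrightarrow> t \<in> {0..h} \<Longrightarrow> p + s *\<^sub>R u + t *\<^sub>R v \<in> S"
  obtains s t where "s \<in> {0..h}" "t \<in> {0..h}"
    "F (p + h *\<^sub>R u + h *\<^sub>R v) - F (p + h *\<^sub>R u) - F (p + h *\<^sub>R v) + F p =
     h\<^sup>2 * frechet_derivative (\<lambda>x. frechet_derivative F (at x) u) (at (p + s *\<^sub>R u + t *\<^sub>R v)) v"
proof -
  let ?D = "\<lambda>x. frechet_derivative F (at x)"
  have C': "Ck_on (Suc (Suc 0)) S F" using C by (simp add: numeral_2_eq_2)
  have D1: "(F has_derivative ?D x) (at x)" if "x \<in> S" for x
    by (rule Ck_on_has_derivative[OF C' that])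
  have D2: "((\<lambda>x. ?D x u) has_derivative frechet_derivative (\<lambda>x. ?D x u) (at x)) (at x)" if "x \<in> S" for x
    by (rule Ck_on_has_derivative[OF _ that, of 0]) (use C' in simp)
  have "\<exists>s>0. s < h \<and>
    (F (p + h *\<^sub>R v + h *\<^sub>R u) - F (p + h *\<^sub>R u)) - (F (p + h *\<^sub>R v + 0 *\<^sub>R u) - F (p + 0 *\<^sub>R u))
     = (h - 0) * (?D (p + h *\<^sub>R v + s *\<^sub>R u) u - ?D (p + s *\<^sub>R u) u)"
  proof (rule MVT2[OF \<open>h > 0\<close>], rule DERIV_diff)
    fix s assume s: "0 \<le> s" "s \<le> h"
    show "((\<lambda>s. F (p + h *\<^sub>R v + s *\<^sub>R u)) has_real_derivative ?D (p + h *\<^sub>R v + s *\<^sub>R u) u) (at s)"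
      using s S[of s h] \<open>h > 0\<close> by (intro has_derivative_on_line D1) (auto simp: algebra_simps)
    show "((\<lambda>s. F (p + s *\<^sub>R u)) has_real_derivative ?D (p + s *\<^sub>R u) u) (at s)"
      using s S[of s 0] \<open>h > 0\<close> by (intro has_derivative_on_line D1) (auto simp: algebra_simps)
  qed
  then obtain s where s: "0 < s" "s < h" and
    1: "F (p + h *\<^sub>R v + h *\<^sub>R u) - F (p + h *\<^sub>R u) - (F (p + h *\<^sub>R v) - F p)
       = h * (?D (p + h *\<^sub>R v + s *\<^sub>R u) u - ?D (p + s *\<^sub>R u) u)"
    by auto
  have "\<exists>t>0. t < h \<and>
    ?D (p + s *\<^sub>R u + h *\<^sub>R v) u - ?D (p + s *\<^sub>R u + 0 *\<^sub>R v) u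
     = (h - 0) * (frechet_derivative (\<lambda>x. ?D x u) (at (p + s *\<^sub>R u + t *\<^sub>R v)) v)"
    using s S[of s] by (intro MVT2[OF \<open>h > 0\<close>] has_derivative_on_line D2) auto
  then obtain t where t: "0 < t" "t < h" and
    2: "?D (p + s *\<^sub>R u + h *\<^sub>R v) u - ?D (p + s *\<^sub>R u) u
        = h * (frechet_derivative (\<lambda>x. ?D x u) (at (p + s *\<^sub>R u + t *\<^sub>R v)) v)"
    by auto
  show thesis
    by (rule that[of s t])
      (use s t 1 2 in \<open>simp_all add: algebra_simps power2_eq_square\<close>)
qed

lemma second_derivative_symmetric:
  fixes F :: "'a::euclidean_space \<Rightarrow> real"
  assumes "open S" "Ck_on 2 S F" "p \<in> S"
  shows "frechet_derivative (\<lambda>x. frechet_derivative F (at x) u) (at p) v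
       = frechet_derivative (\<lambda>x. frechet_derivative F (at x) v) (at p) u"
proof -
  define D2 where "D2 u v x = frechet_derivative (\<lambda>x. frechet_derivative F (at x) u) (at x) v" for u v x
  have cont: "isCont (D2 u v) p" for u v
  proof -
    have "Ck_on (Suc (Suc 0)) S F" using assms(2) by (simp add: numeral_2_eq_2)
    then have "continuous_on S (D2 u v)" by (simp add: D2_def[abs_def])
    then show ?thesis using assms by (simp add: continuous_on_eq_continuous_at)
  qed
  have "\<bar>D2 u v p - D2 v u p\<bar> \<le> e" if "e > 0" for e
  proof -
    have lim: "((\<lambda>x. \<bar>D2 a b x - D2 a b p\<bar>) \<longlongrightarrow> 0) (nhds p)" for a b
      using tendsto_rabs_zero[OF LIM_zero[OF cont[of a b, unfolded isCont_def]]] 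
      by (simp add: tendsto_nhds_iff)
    have "\<forall>\<^sub>F x in nhds p. \<bar>D2 u v x - D2 u v p\<bar> < e / 2"
         "\<forall>\<^sub>F x in nhds p. \<bar>D2 v u x - D2 v u p\<bar> < e / 2"
         "\<forall>\<^sub>F x in nhds p. x \<in> S"
      using order_tendstoD(2)[OF lim, of "e/2"] order_tendstoD(2)[OF lim, of "e/2"] \<open>e > 0\<close> eventually_nhds_in_open[OF assms(1,3)]
      by auto
    then have "\<forall>\<^sub>F x in nhds p. x \<in> S \<and> \<bar>D2 u v x - D2 u v p\<bar> < e / 2 \<and> \<bar>D2 v u x - D2 v u p\<bar> < e / 2"
      by eventually_elim auto
    then obtain d where "d > 0" and d: "\<And>x. dist x p < d \<Longrightarrow>
        x \<in> S \<and> \<bar>D2 u v x - D2 u v p\<bar> < e / 2 \<and> \<bar>D2 v u x - D2 v u p\<bar> < e / 2"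
      unfolding eventually_nhds_metric by blast
    (* Small enough that the whole parallelogram with sides h u and h v lies in the d-ball; the
       summand 1 covers the case u = v = 0. *)
    define h where "h = d / (norm u + norm v + 1)"
    have n: "norm u + norm v + 1 > 0" by (simp add: add_nonneg_pos)
    then have "h > 0" using \<open>d > 0\<close> by (simp add: h_def)
    have near: "dist (p + s *\<^sub>R a + t *\<^sub>R b) p < d"
      if "s \<in> {0..h}" "t \<in> {0..h}" "norm a + norm b = norm u + norm v" for s t a b
    proof -
      have "dist (p + s *\<^sub>R a + t *\<^sub>R b) p \<le> s * norm a + t * norm b"
        using that norm_triangle_ineq[of "s *\<^sub>R a" "t *\<^sub>R b"] by (simp add: dist_norm add.assoc)
      also have "\<dots> \<le> h * norm a + h * norm b"
        using that by (intro add_mono mult_right_mono) auto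
      also have "\<dots> = h * (norm u + norm v)" using that(3) by (simp flip: distrib_left)
      also have "\<dots> < h * (norm u + norm v + 1)" using \<open>h > 0\<close> by simp
      also have "\<dots> = d" using n by (simp add: h_def)
      finally show ?thesis .
    qed
    obtain s t where st: "s \<in> {0..h}" "t \<in> {0..h}"
      "F (p + h *\<^sub>R u + h *\<^sub>R v) - F (p + h *\<^sub>R u) - F (p + h *\<^sub>R v) + F p
        = h\<^sup>2 * D2 u v (p + s *\<^sub>R u + t *\<^sub>R v)"
      using second_difference_mean_value[OF assms(2) \<open>h > 0\<close>, of p u v] near d
      unfolding D2_def by metis
    obtain s' t' where st': "s' \<in> {0..h}" "t' \<in> {0..h}"
      "F (p + h *\<^sub>R v + h *\<^sub>R u) - F (p + h *\<^sub>R v) - F (p + h *\<^sub>R u) + F p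
        = h\<^sup>2 * D2 v u (p + s' *\<^sub>R v + t' *\<^sub>R u)"
      using second_difference_mean_value[OF assms(2) \<open>h > 0\<close>, of p v u] near[of _ _ v u] d
      unfolding D2_def by (metis add.commute)
    have "h\<^sup>2 * D2 u v (p + s *\<^sub>R u + t *\<^sub>R v) = h\<^sup>2 * D2 v u (p + s' *\<^sub>R v + t' *\<^sub>R u)"
      using st(3) st'(3) by (simp add: algebra_simps)
    then have "D2 u v (p + s *\<^sub>R u + t *\<^sub>R v) = D2 v u (p + s' *\<^sub>R v + t' *\<^sub>R u)"
      using \<open>h > 0\<close> by simp
    moreover have "\<bar>D2 u v (p + s *\<^sub>R u + t *\<^sub>R v) - D2 u v p\<bar> < e / 2"
      using d near[OF st(1,2)] by simp
    moreover have "\<bar>D2 v u (p + s' *\<^sub>R v + t' *\<^sub>R u) - D2 v u p\<bar> < e / 2"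
      using d near[OF st'(1,2)] by simp
    ultimately show ?thesis by (simp add: abs_if split: if_splits)
  qed
  from field_le_epsilon[of "\<bar>D2 u v p - D2 v u p\<bar>" 0] this show ?thesis
    by (auto simp: D2_def)
qed

section \<open>Gradients\<close>

lemma gradient_eqI:
  assumes "GDERIV f x :> D"
  shows "gradient f x = D"
  unfolding gradient_def
proof (rule the_equality[where P = "\<lambda>D. GDERIV f x :> D", OF assms])
  fix E assume "GDERIV f x :> E"
  with assms have "(\<lambda>h. h \<bullet> E) = (\<lambda>h. h \<bullet> D)"
    unfolding gderiv_def by (metis has_derivative_unique)
  then show "E = D" by (metis vector_eq_ldot)
qed

lemma gradient_inner:
  assumes "f differentiable (at x)"
  shows "v \<bullet> gradient f x = frechet_derivative f (at x) v"
    and "GDERIV f x :> gradient f x"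
proof -
  have D: "(f has_derivative frechet_derivative f (at x)) (at x)"
    using assms by (simp add: frechet_derivative_works[symmetric])
  define G where "G = (\<Sum>b\<in>Basis. frechet_derivative f (at x) b *\<^sub>R b)"
  have eq: "frechet_derivative f (at x) v = v \<bullet> G" for v
    using linear_euclidean_expand[OF has_derivative_linear[OF D], of v]
    by (simp add: G_def inner_sum_right mult.commute)
  have "GDERIV f x :> G"
    using D unfolding gderiv_def eq[abs_def] .
  then show "GDERIV f x :> gradient f x" "v \<bullet> gradient f x = frechet_derivative f (at x) v"
    using gradient_eqI eq by metis+
qed

lemma smooth_on_gradient:
  fixes F :: "'a::euclidean_space \<Rightarrow> real"
  assumes "open S" "smooth_on S F"
  shows "smooth_on S (gradient F)"
  unfolding smooth_on_def
proof
  fix k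
  have C: "Ck_on (Suc k) S F" using assms(2) unfolding smooth_on_def by blast
  show "Ck_on k S (gradient F)"
  proof (rule Ck_on_cong[OF \<open>open S\<close>])
    show "Ck_on k S (\<lambda>x. \<Sum>b\<in>Basis. frechet_derivative F (at x) b *\<^sub>R b)"
      using C by (intro Ck_on_sum Ck_on_scaleR Ck_on_const \<open>open S\<close>) simp
    show "(\<Sum>b\<in>Basis. frechet_derivative F (at x) b *\<^sub>R b) = gradient F x" if "x \<in> S" for x
    proof -
      have "F differentiable (at x)" using C that by simp
      then show ?thesis
        by (simp add: gradient_inner(1)[symmetric] inner_commute[of _ "gradient F x"] euclidean_representation)
    qed
  qed
qed

text \<open>
  Stated for the gradient on the whole space, so that on a product space the three block identities
  for the second partial derivatives are contained in a single one.
\<close>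

lemma gradient_derivative_symmetric:
  fixes F :: "'a::euclidean_space \<Rightarrow> real"
  assumes "open S" "smooth_on S F" "x \<in> S"
  shows "u \<bullet> frechet_derivative (gradient F) (at x) v = v \<bullet> frechet_derivative (gradient F) (at x) u"
proof -
  have *: "frechet_derivative (\<lambda>y. frechet_derivative F (at y) u) (at x) v
      = u \<bullet> frechet_derivative (gradient F) (at x) v" for u v
  proof -
    have "(gradient F has_derivative frechet_derivative (gradient F) (at x)) (at x)"
      by (rule smooth_on_has_derivative[OF smooth_on_gradient[OF assms(1,2)] assms(3)])
    from has_derivative_inner_right[OF this, of u]
    have "((\<lambda>y. frechet_derivative F (at y) u) has_derivative
        (\<lambda>v. u \<bullet> frechet_derivative (gradient F) (at x) v)) (at x)"
    proof (rule has_derivative_transform_within_open)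
      fix y assume "y \<in> S"
      then have "F differentiable (at y)"
        using smooth_on_has_derivative[OF assms(2)] by (auto simp: differentiable_def)
      then show "u \<bullet> gradient F y = frechet_derivative F (at y) u"
        by (rule gradient_inner)
    qed (use assms in auto)
    then show ?thesis by (metis frechet_derivative_at)
  qed
  have "Ck_on 2 S F" using assms(2) by (simp add: smooth_on_def)
  from second_derivative_symmetric[OF assms(1) this assms(3), of u v]
  show ?thesis by (simp add: *)
qed

section \<open>Symplectic maps from generating functions\<close>

lemma open_image_homeomorphism:
  assumes "homeomorphism U V f g" "open V" "open W" "W \<subseteq> U"
  shows "open (f ` W)"
proof -
  have "open (V \<inter> g -` W)"
    using assms by (auto intro: continuous_open_preimage simp: homeomorphism_def)
  moreover have "V \<inter> g -` W = f ` W"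
    using assms(1,4) unfolding homeomorphism_def by (force simp: image_iff)
  ultimately show ?thesis by simp
qed

lemma symplectic_form_inner: "symplectic_form u v = fst u \<bullet> snd v - fst v \<bullet> snd u"
  by (simp add: symplectic_form_def inner_vec_def sum_subtractf)

text \<open>
  The graph of the step map is parametrised by the mixed point \<open>w = (y', z)\<close>: \<open>A w\<close> is its source
  \<open>(y, z)\<close> and \<open>B w\<close> its target \<open>(y', z')\<close>. The Jacobians of \<open>A\<close> and \<open>B\<close> are block triangular with
  an identity block and, as the remaining block, the mixed Hessian or its transpose, so one
  determinant condition makes both maps local diffeomorphisms and \<open>\<Phi> = B \<circ> A\<inverse>\<close> is defined. Pulled
  back along the parametrisation, preservation of the symplectic form is exactly the symmetry of
  the full Hessian of the generating function.
\<close>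

lemma generating_function_symplectomorphism:
  fixes F :: "(real^'n) \<times> (real^'n) \<Rightarrow> real"
  defines "G \<equiv> gradient F"
  defines "A \<equiv> \<lambda>p. (snd (G p), snd p)" and "B \<equiv> \<lambda>p. (fst p, fst (G p))"
  assumes F: "smooth_on UNIV F"
    and det: "det (\<chi> i j. snd (frechet_derivative G (at p) (axis i 1, 0)) $ j) \<noteq> 0"
  obtains W U V \<Phi> where "open W" "p \<in> W" "symplectomorphism U V \<Phi>"
    "U = A ` W" "\<And>w. w \<in> W \<Longrightarrow> \<Phi> (A w) = B w"
proof -
  define G' where "G' w = frechet_derivative G (at w)" for w
  have G: "smooth_on UNIV G"
    unfolding G_def by (rule smooth_on_gradient[OF open_UNIV F])
  have D_G: "(G has_derivative G' w) (at w)" for w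
    unfolding G'_def by (rule smooth_on_has_derivative[OF G UNIV_I])
  have lin_G: "linear (G' w)" for w
    by (rule has_derivative_linear[OF D_G])
  have sym: "u \<bullet> G' w v = v \<bullet> G' w u" for u v w
    unfolding G'_def G_def by (rule gradient_derivative_symmetric[OF open_UNIV F UNIV_I])
  define A' where "A' w h = (snd (G' w h), snd h)" for w h
  define B' where "B' w h = (fst h, fst (G' w h))" for w h
  have D_A: "(A has_derivative A' w) (at w)" and D_B: "(B has_derivative B' w) (at w)" for w
    unfolding A_def B_def A'_def[abs_def] B'_def[abs_def]
    by (auto intro!: derivative_eq_intros D_G)
  have fA: "frechet_derivative A (at w) = A' w" and fB: "frechet_derivative B (at w) = B' w" for w
    by (rule frechet_derivative_at[OF D_A, symmetric] frechet_derivative_at[OF D_B, symmetric])+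
  have sA: "smooth_on UNIV A" and sB: "smooth_on UNIV B"
    unfolding A_def B_def
    by (intro smooth_on_Pair smooth_on_linear[OF open_UNIV bounded_linear_fst G]
        smooth_on_linear[OF open_UNIV bounded_linear_snd G]
        smooth_on_bounded_linear bounded_linear_fst bounded_linear_snd open_UNIV)+

  (* a and b are the nontrivial blocks of A' and B' at p. The matrix M of the hypothesis is the
     transpose of that of a by definition, and equals that of b by the symmetry of G'. *)
  define M where "M = (\<chi> i j. snd (G' p (axis i 1, 0)) $ j)"
  define a where "a x = snd (G' p (x, 0))" for x
  define b where "b x = fst (G' p (0, x))" for x
  have lin_a: "linear a" and lin_b: "linear b"
    unfolding a_def b_def
    by (auto intro!: linearI simp flip: fst_add snd_add fst_scaleR snd_scaleR
        linear_add[OF lin_G] linear_scale[OF lin_G])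
  have "M = transpose (matrix a)"
    by (simp add: M_def a_def matrix_def transpose_def vec_eq_iff)
  then have inj_a: "inj a"
    using det det_nz_iff_inj[OF lin_a] by (simp add: M_def G'_def det_transpose)
  have "b (axis j 1) $ i = a (axis i 1) $ j" for i j
    using sym[of "(axis i 1, 0)" p "(0, axis j 1)"]
    by (simp add: a_def b_def inner_prod_def inner_axis')
  then have "M = matrix b"
    by (simp add: M_def a_def matrix_def vec_eq_iff)
  then have inj_b: "inj b"
    using det det_nz_iff_inj[OF lin_b] by (simp add: M_def G'_def)
  have "inj (A' p)"
    unfolding linear_injective_0[OF has_derivative_linear[OF D_A]]
    using inj_a linear_injective_0[OF lin_a] by (auto simp: A'_def a_def zero_prod_def)
  then obtain UA VA gA where *: "open UA" "p \<in> UA" "open VA" "homeomorphism UA VA A gA"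
      "smooth_on VA gA" "\<And>w. w \<in> UA \<Longrightarrow> bij (A' w)"
    using smooth_inverse_function[OF open_UNIV sA UNIV_I, of p] unfolding fA by metis
  have "inj (B' p)"
    unfolding linear_injective_0[OF has_derivative_linear[OF D_B]]
    using inj_b linear_injective_0[OF lin_b] by (auto simp: B'_def b_def zero_prod_def)
  then obtain UB VB gB where **: "open UB" "p \<in> UB" "open VB" "homeomorphism UB VB B gB"
      "smooth_on VB gB"
    using smooth_inverse_function[OF open_UNIV sB UNIV_I, of p] unfolding fB by metis

  (* On UA the source determines w, on UB the target does; injectivity of \<Phi> needs both. *)
  define W where "W = UA \<inter> UB"
  define U where "U = A ` W"
  define V where "V = B ` W"
  define \<Phi> where "\<Phi> x = B (gA x)" for x
  have "open W" "p \<in> W" using * ** by (auto simp: W_def)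
  have "open U" "open V"
    unfolding U_def V_def
    using * ** \<open>open W\<close> by (auto intro: open_image_homeomorphism simp: W_def)
  have gA: "gA (A w) = w" and gB: "gB (B w) = w" if "w \<in> W" for w
    using that *(4) **(4) by (auto simp: W_def homeomorphism_def)
  have \<Phi>_A: "\<Phi> (A w) = B w" if "w \<in> W" for w
    using gA[OF that] by (simp add: \<Phi>_def)
  have "U \<subseteq> VA" "V \<subseteq> VB"
    using *(4) **(4) by (auto simp: U_def V_def W_def homeomorphism_def)
  have inj_B: "inj_on B W"
    using gB by (metis inj_on_inverseI)
  have inj_\<Phi>: "inj_on \<Phi> U"
    using inj_B \<Phi>_A by (auto simp: inj_on_def U_def)
  have s\<Phi>: "smooth_on U \<Phi>"
    unfolding \<Phi>_def
    by (rule smooth_on_compose[OF \<open>open U\<close> open_UNIV _ smooth_on_subset[OF *(5) \<open>U \<subseteq> VA\<close>] sB]) simp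
  have "smooth_on V (inv_into U \<Phi>)"
  proof (rule smooth_on_cong[OF \<open>open V\<close>])
    show "smooth_on V (\<lambda>x. A (gB x))"
      by (rule smooth_on_compose[OF \<open>open V\<close> open_UNIV _ smooth_on_subset[OF **(5) \<open>V \<subseteq> VB\<close>] sA]) simp
    fix x assume "x \<in> V"
    then obtain w where w: "w \<in> W" "x = B w" by (auto simp: V_def)
    then have "inv_into U \<Phi> (\<Phi> (A w)) = A w"
      by (intro inv_into_f_f inj_\<Phi>) (simp add: U_def)
    then show "A (gB x) = inv_into U \<Phi> x" using w gB \<Phi>_A by simp
  qed
  moreover have "symplectic_form (frechet_derivative \<Phi> (at q) u) (frechet_derivative \<Phi> (at q) v)
      = symplectic_form u v"
    if "q \<in> U" for q u v
  proof -
    obtain w where w: "w \<in> W" "q = A w" using \<open>q \<in> U\<close> unfolding U_def by blast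
    have "(\<Phi> has_derivative frechet_derivative \<Phi> (at (A w))) (at (A w))"
      using smooth_on_has_derivative[OF s\<Phi>] that w by simp
    from has_derivative_compose[OF D_A this]
    have "(B has_derivative (\<lambda>h. frechet_derivative \<Phi> (at (A w)) (A' w h))) (at w)"
      by (rule has_derivative_transform_within_open[OF _ \<open>open W\<close> w(1)]) (rule \<Phi>_A)
    from has_derivative_unique[OF this D_B]
    have B': "frechet_derivative \<Phi> (at q) (A' w h) = B' w h" for h
      unfolding w(2) by (rule fun_cong)
    (* Since A' is onto, the tangent vectors at A w may be written as images of tangent vectors m, n
       of the parametrising space; then only the symmetry of G' w remains. *)
    have "surj (A' w)" using *(6)[of w] w by (simp add: W_def bij_is_surj)
    then obtain m n where mn: "u = A' w m" "v = A' w n" by (metis surjD)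
    have "fst m \<bullet> fst (G' w n) + snd m \<bullet> snd (G' w n) = fst n \<bullet> fst (G' w m) + snd n \<bullet> snd (G' w m)"
      using sym[of m w n] by (simp add: inner_prod_def)
    then show ?thesis
      unfolding mn B' by (simp add: symplectic_form_inner A'_def B'_def inner_commute)
  qed
  moreover have "bij_betw \<Phi> U V"
    using inj_\<Phi> \<Phi>_A by (force simp: bij_betw_def U_def V_def image_iff)
  ultimately have "symplectomorphism U V \<Phi>"
    using \<open>open U\<close> \<open>open V\<close> s\<Phi> by (simp add: symplectomorphism_def)
  then show thesis
    using that \<open>open W\<close> \<open>p \<in> W\<close> U_def \<Phi>_A by blast
qed

section \<open>The discrete Hamiltonian system\<close>

lemma grad_of_differentiable:
  fixes f :: "real^'n \<Rightarrow> real^'n \<Rightarrow> real"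
  assumes "(\<lambda>(y, z). f y z) differentiable (at (y, z))"
  shows "GDERIV (\<lambda>u. f u z) y :> fst (gradient (\<lambda>(y, z). f y z) (y, z))"
    and "GDERIV (\<lambda>u. f y u) z :> snd (gradient (\<lambda>(y, z). f y z) (y, z))"
proof -
  let ?G = "gradient (\<lambda>(y, z). f y z) (y, z)"
  have D: "((\<lambda>(y, z). f y z) has_derivative (\<lambda>h. h \<bullet> ?G)) (at (y, z))"
    using gradient_inner(2)[OF assms] by (simp add: gderiv_def)
  have "((\<lambda>u. (u, z)) has_derivative (\<lambda>h. (h, 0))) (at y)"
    "((\<lambda>u. (y, u)) has_derivative (\<lambda>h. (0, h))) (at z)"
    by (auto intro!: derivative_eq_intros)
  from this[THEN has_derivative_compose, of "\<lambda>(y, z). f y z", OF D]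
  show "GDERIV (\<lambda>u. f u z) y :> fst ?G" "GDERIV (\<lambda>u. f y u) z :> snd ?G"
    by (simp_all add: gderiv_def inner_prod_def)
qed

lemma grad_S\<^sub>2:
  fixes H :: "int \<Rightarrow> real^'n \<Rightarrow> real^'n \<Rightarrow> real"
  assumes "(\<lambda>(y, z). H t y z) differentiable (at (y', z))"
  shows "grad_y (S\<^sub>2 H t) y' z = z - grad_y (H t) y' z"
    and "grad_z (S\<^sub>2 H t) y' z = y' - grad_z (H t) y' z"
proof -
  have 1: "GDERIV (\<lambda>u. z \<bullet> u) y' :> z" "GDERIV (\<lambda>u. u \<bullet> y') z :> y'"
    by (auto simp: gderiv_def inner_commute intro!: derivative_eq_intros)
  note 2 = grad_of_differentiable[OF assms]
  show "grad_y (S\<^sub>2 H t) y' z = z - grad_y (H t) y' z"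
    "grad_z (S\<^sub>2 H t) y' z = y' - grad_z (H t) y' z"
    unfolding grad_y_def grad_z_def S\<^sub>2_def gradient_eqI[OF 2(1)] gradient_eqI[OF 2(2)]
    by (intro gradient_eqI GDERIV_diff 1 2)+
qed

lemma smooth_on_S\<^sub>2:
  fixes H :: "int \<Rightarrow> real^'n \<Rightarrow> real^'n \<Rightarrow> real"
  assumes "smooth_on UNIV (\<lambda>(y, z). H t y z)"
  shows "smooth_on UNIV (\<lambda>(y, z). S\<^sub>2 H t y z)"
proof -
  have "Ck_on k UNIV (\<lambda>p. snd p \<bullet> fst p + - (\<lambda>(y, z). H t y z) p)" for k
  proof (rule Ck_on_add[OF open_UNIV])
    show "Ck_on k UNIV (\<lambda>p::(real^'n) \<times> (real^'n). snd p \<bullet> fst p)"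
    proof (rule Ck_on_family_apply[OF open_UNIV, of "\<lambda>p w. snd p \<bullet> w"])
      show "linear (\<lambda>w. snd p \<bullet> w)" for p :: "(real^'n) \<times> (real^'n)"
        by (simp add: bounded_linear.linear bounded_linear_inner_right)
      show "Ck_on k UNIV (\<lambda>p::(real^'n) \<times> (real^'n). snd p \<bullet> v)" for v
        by (rule Ck_on_linear[OF open_UNIV _ Ck_on_ident[OF open_UNIV]])
          (intro bounded_linear_inner_left_comp bounded_linear_snd)
      show "Ck_on k UNIV (\<lambda>p::(real^'n) \<times> (real^'n). fst p)"
        by (rule Ck_on_linear[OF open_UNIV bounded_linear_fst Ck_on_ident[OF open_UNIV]])
    qed
    show "Ck_on k UNIV (\<lambda>p. - (\<lambda>(y, z). H t y z) p)"
      using assms by (intro Ck_on_linear[OF open_UNIV bounded_linear_minus[OF bounded_linear_ident]])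
        (simp add: smooth_on_def)
  qed
  then show ?thesis
    by (simp add: smooth_on_def S\<^sub>2_def case_prod_unfold)
qed

text \<open>
  This identifies the matrix of the nondegeneracy condition with a block of the derivative of the
  full gradient, the form in which the determinant enters the inverse function argument.
\<close>

lemma mixed_hessian_gradient:
  fixes f :: "real^'n \<Rightarrow> real^'n \<Rightarrow> real"
  assumes "smooth_on UNIV (\<lambda>(y, z). f y z)"
  shows "mixed_hessian f y z =
    (\<chi> i j. snd (frechet_derivative (gradient (\<lambda>(y, z). f y z)) (at (y, z)) (axis i 1, 0)) $ j)"
proof -
  let ?G = "gradient (\<lambda>(y, z). f y z)"
  have "(\<lambda>(y, z). f y z) differentiable (at p)" for p
    using smooth_on_differentiable[OF assms] by blast
  then have grad: "grad_z f u z = snd (?G (u, z))" for u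
    unfolding grad_z_def by (rule gradient_eqI[OF grad_of_differentiable(2)])
  have D: "(?G has_derivative frechet_derivative ?G (at (y, z))) (at (y, z))"
    by (rule smooth_on_has_derivative[OF smooth_on_gradient[OF open_UNIV assms] UNIV_I])
  have "((\<lambda>u. (u, z)) has_derivative (\<lambda>h. (h, 0))) (at y)"
    by (auto intro!: derivative_eq_intros)
  from has_derivative_compose[OF this D]
  have "((\<lambda>u. snd (?G (u, z)) $ j) has_derivative
      (\<lambda>h. snd (frechet_derivative ?G (at (y, z)) (h, 0)) $ j)) (at y)" for j
    by (intro bounded_linear.has_derivative[OF bounded_linear_vec_nth] has_derivative_snd)
  from frechet_derivative_at[OF this, symmetric] show ?thesis
    by (simp add: mixed_hessian_def grad)
qed

theorem mainTheorem6:
  fixes H :: "int \<Rightarrow> real^'n \<Rightarrow> real^'n \<Rightarrow> real"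
  assumes "\<And>t. smooth_on UNIV (\<lambda>(y, z). H t y z)"
  shows "(\<forall>y z t. discrete_hamiltonian_at H y z t \<longleftrightarrow>
            y t = grad_z (S\<^sub>2 H t) (y (t + 1)) (z t) \<and>
            z (t + 1) = grad_y (S\<^sub>2 H t) (y (t + 1)) (z t)) \<and>
         (\<forall>t y' z. det (mixed_hessian (S\<^sub>2 H t) y' z) \<noteq> 0 \<longrightarrow>
            (\<exists>W. open W \<and> (y', z) \<in> W \<and> defines_symplectomorphism_on H t W))"
proof -
  have diff: "(\<lambda>(y, z). H t y z) differentiable (at p)" for t p
    using smooth_on_differentiable[OF assms] by blast
  have equiv: "discrete_hamiltonian_at H y z t \<longleftrightarrow>
            y t = grad_z (S\<^sub>2 H t) (y (t + 1)) (z t) \<and>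
            z (t + 1) = grad_y (S\<^sub>2 H t) (y (t + 1)) (z t)" for y z t
    unfolding discrete_hamiltonian_at_def fwd_diff_def grad_S\<^sub>2[OF diff]
    by (auto simp: algebra_simps)
  have "\<exists>W. open W \<and> (y', z) \<in> W \<and> defines_symplectomorphism_on H t W"
    if det: "det (mixed_hessian (S\<^sub>2 H t) y' z) \<noteq> 0" for t y' z
  proof -
    let ?F = "\<lambda>(y, z). S\<^sub>2 H t y z"
    let ?G = "gradient ?F"
    have F: "smooth_on UNIV ?F" by (rule smooth_on_S\<^sub>2[OF assms])
    have "?F differentiable (at p)" for p
      using smooth_on_differentiable[OF F] by blast
    then have grads: "grad_y (S\<^sub>2 H t) y z = fst (?G (y, z))"
      "grad_z (S\<^sub>2 H t) y z = snd (?G (y, z))" for y z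
      unfolding grad_y_def grad_z_def
      by (rule gradient_eqI[OF grad_of_differentiable(1)] gradient_eqI[OF grad_of_differentiable(2)];
          blast)+
    obtain W U V \<Phi> where W: "open W" "(y', z) \<in> W" "symplectomorphism U V \<Phi>"
      and U: "U = (\<lambda>p. (snd (?G p), snd p)) ` W"
      and \<Phi>: "\<And>w. w \<in> W \<Longrightarrow> \<Phi> (snd (?G w), snd w) = (fst w, fst (?G w))"
      by (rule generating_function_symplectomorphism[OF F, of "(y', z)"])
        (use det in \<open>simp add: mixed_hessian_gradient[OF F]\<close>)+
    have "(y (t + 1), z t) \<in> W \<and> discrete_hamiltonian_at H y z t \<longleftrightarrow>
          (y t, z t) \<in> U \<and> (y (t + 1), z (t + 1)) = \<Phi> (y t, z t)" (is "?L \<longleftrightarrow> ?R") for y z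
    proof
      assume ?L
      then have w: "(y (t + 1), z t) \<in> W" and
        "y t = snd (?G (y (t + 1), z t))" "z (t + 1) = fst (?G (y (t + 1), z t))"
        by (auto simp: equiv grads)
      then show ?R
        using \<Phi>[OF w] by (auto simp: U image_iff intro!: bexI[OF _ w])
    next
      assume ?R
      then obtain w where w: "w \<in> W" "y t = snd (?G w)" "z t = snd w" by (auto simp: U)
      with \<Phi>[OF w(1)] \<open>?R\<close> have "y (t + 1) = fst w" "z (t + 1) = fst (?G w)" by auto
      with w show ?L by (simp add: equiv grads)
    qed
    then show ?thesis
      using W unfolding defines_symplectomorphism_on_def by blast
  qed
  with equiv show ?thesis by blast
qed

end
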